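(* Let $\mathcal{C}$ be a left cancellative small category. Then $\mathrm{ZM}(\mathcal{C})$ admits unique maximal idempotents, and the paths in $\mathrm{ZM}(\mathcal{C})$ are precisely the elements of the form $\tau_\alpha$ for $\alpha\in\mathcal{C}$. Additionally, for any $\phi_\zeta$ in $\mathrm{ZM}(\mathcal{C})$, $$P_{\phi_\zeta}=\{\tau_\alpha:\alpha\in\operatorname{dom}(\phi_\zeta)\}.$$
   Context: Categories. A small category $\mathcal{C}$ is identified with its set of morphisms; $\mathcal{C}^0$ is the set of objects, each object being identified with its identity morphism; $r,s:\mathcal{C}\to\mathcal{C}^0$ are the range and source maps, and $\alpha\beta$ is defined if and only if $s(\alpha)=r(\beta)$. For $\alpha\in\mathcal{C}$, $\alpha\mathcal{C}=\{\alpha\beta:\beta\in\mathcal{C},\ s(\alpha)=r(\beta)\}$. $\mathcal{C}$ is left cancellative if $\alpha\beta=\alpha\gamma$ (both products defined) implies $\beta=\gamma$. Zigzag inverse semigroup. $I(\mathcal{C})$ is the inverse semigroup of all partial bijections of the set $\mathcal{C}$ under composition on the largest possible domain, with $0$ the empty map. For $\alpha\in\mathcal{C}$ let $\tau_\alpha:s(\alpha)\mathcal{C}\to\alpha\mathcal{C}$, $\tau_\alpha(x)=\alpha x$. A zigzag in $\mathcal{C}$ is a tuple $\zeta=(\alpha_1,\beta_1,\dots,\alpha_n,\beta_n)$ ($n\ge 1$) of elements of $\mathcal{C}$ with $r(\alpha_i)=r(\beta_i)$ for $1\le i\le n$ and $s(\beta_i)=s(\alpha_{i+1})$ for $1\le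 i\le n-1$; its zigzag map is $\phi_\zeta=\tau_{\alpha_1}^{-1}\tau_{\beta_1}\cdots\tau_{\alpha_n}^{-1}\tau_{\beta_n}\in I(\mathcal{C})$. $\mathrm{ZM}(\mathcal{C})$ is the inverse subsemigroup of $I(\mathcal{C})$ consisting of all zigzag maps and the empty map $0$. Inverse semigroups. In an inverse semigroup $S$ with zero, $s^*$ denotes the inverse of $s$, and idempotents are ordered by $e\le f\iff e=ef$. A maximal idempotent is an idempotent that is maximal among the nonzero idempotents. $S$ admits unique maximal idempotents if for every nonzero idempotent $e$ there is a unique maximal idempotent above $e$. For such $S$, $s\in S$ is a path if $s^*s$ is a maximal idempotent. A path $x$ is a domain path of $s\in S$ if $xx^*\le s^*s$; $P_s$ denotes the set of domain paths of $s$. *)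

theory Defs
  imports "HOL-Algebra.Congruence"
begin

section \<open>Inverse semigroups with zero\<close>

record 'a semigroup_zero = "'a partial_object" +
  mult :: "'a \<Rightarrow> 'a \<Rightarrow> 'a" (infixl \<open>\<odot>\<index>\<close> 70)
  zero :: 'a (\<open>\<zero>\<index>\<close>)

locale inverse_semigroup_zero =
  fixes S :: "('a, 'b) semigroup_zero_scheme" (structure)
  assumes mult_closed: "x \<in> carrier S \<Longrightarrow> y \<in> carrier S \<Longrightarrow> x \<odot> y \<in> carrier S"
    and mult_assoc: "x \<in> carrier S \<Longrightarrow> y \<in> carrier S \<Longrightarrow> z \<in> carrier S \<Longrightarrow>
      (x \<odot> y) \<odot> z = x \<odot> (y \<odot> z)"
    and zero_closed: "\<zero> \<in> carrier S"
    and zero_left: "x \<in> carrier S \<Longrightarrow> \<zero> \<odot> x = \<zero>"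
    and zero_right: "x \<in> carrier S \<Longrightarrow> x \<odot> \<zero> = \<zero>"
    and ex1_inverse: "x \<in> carrier S \<Longrightarrow>
      \<exists>!y. y \<in> carrier S \<and> x \<odot> y \<odot> x = x \<and> y \<odot> x \<odot> y = y"

definition sg_inverse :: "('a, 'b) semigroup_zero_scheme \<Rightarrow> 'a \<Rightarrow> 'a" where
  "sg_inverse S x = (THE y. y \<in> carrier S \<and>
     x \<odot>\<^bsub>S\<^esub> y \<odot>\<^bsub>S\<^esub> x = x \<and> y \<odot>\<^bsub>S\<^esub> x \<odot>\<^bsub>S\<^esub> y = y)"

definition idempotents :: "('a, 'b) semigroup_zero_scheme \<Rightarrow> 'a set" where
  "idempotents S = {e \<in> carrier S. e \<odot>\<^bsub>S\<^esub> e = e}"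

definition idem_le :: "('a, 'b) semigroup_zero_scheme \<Rightarrow> 'a \<Rightarrow> 'a \<Rightarrow> bool" where
  "idem_le S e f \<longleftrightarrow> e = e \<odot>\<^bsub>S\<^esub> f"

definition maximal_idempotent :: "('a, 'b) semigroup_zero_scheme \<Rightarrow> 'a \<Rightarrow> bool" where
  "maximal_idempotent S e \<longleftrightarrow> e \<in> idempotents S \<and> e \<noteq> \<zero>\<^bsub>S\<^esub> \<and>
     (\<forall>f \<in> idempotents S. f \<noteq> \<zero>\<^bsub>S\<^esub> \<longrightarrow> idem_le S e f \<longrightarrow> f = e)"

definition admits_unique_maximal_idempotents :: "('a, 'b) semigroup_zero_scheme \<Rightarrow> bool" where
  "admits_unique_maximal_idempotents S \<longleftrightarrow>
     (\<forall>e \<in> idempotents S. e \<noteq> \<zero>\<^bsub>S\<^esub> \<longrightarrow> (\<exists>!f. maximal_idempotent S f \<and> idem_le S e f))"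

definition sg_paths :: "('a, 'b) semigroup_zero_scheme \<Rightarrow> 'a set" where
  "sg_paths S = {x \<in> carrier S. maximal_idempotent S (sg_inverse S x \<odot>\<^bsub>S\<^esub> x)}"

definition domain_paths :: "('a, 'b) semigroup_zero_scheme \<Rightarrow> 'a \<Rightarrow> 'a set" where
  "domain_paths S s = {x \<in> sg_paths S.
     idem_le S (x \<odot>\<^bsub>S\<^esub> sg_inverse S x) (sg_inverse S s \<odot>\<^bsub>S\<^esub> s)}"


section \<open>Small categories as sets of morphisms\<close>

text \<open>The carrier is the set of morphisms; an object is identified with its identity morphism, so
  objects are particular elements of the carrier. The value of \<open>comp\<close> on a pair of
  morphisms that is not composable carries no meaning.\<close>

record 'a category_data = "'a partial_object" +
  objects :: "'a set"
  rng :: "'a \<Rightarrow> 'a" (\<open>r\<index>\<close>)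
  src :: "'a \<Rightarrow> 'a" (\<open>s\<index>\<close>)
  comp :: "'a \<Rightarrow> 'a \<Rightarrow> 'a" (infixl \<open>\<bullet>\<index>\<close> 70)

locale small_category =
  fixes C :: "('a, 'b) category_data_scheme" (structure)
  assumes objects_subset: "objects C \<subseteq> carrier C"
    and rng_object: "\<alpha> \<in> carrier C \<Longrightarrow> r \<alpha> \<in> objects C"
    and src_object: "\<alpha> \<in> carrier C \<Longrightarrow> s \<alpha> \<in> objects C"
    and rng_of_object: "v \<in> objects C \<Longrightarrow> r v = v"
    and src_of_object: "v \<in> objects C \<Longrightarrow> s v = v"
    and comp_closed: "\<alpha> \<in> carrier C \<Longrightarrow> \<beta> \<in> carrier C \<Longrightarrow> s \<alpha> = r \<beta> \<Longrightarrow> \<alpha> \<bullet> \<beta> \<in> carrier C"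
    and rng_comp: "\<alpha> \<in> carrier C \<Longrightarrow> \<beta> \<in> carrier C \<Longrightarrow> s \<alpha> = r \<beta> \<Longrightarrow> r (\<alpha> \<bullet> \<beta>) = r \<alpha>"
    and src_comp: "\<alpha> \<in> carrier C \<Longrightarrow> \<beta> \<in> carrier C \<Longrightarrow> s \<alpha> = r \<beta> \<Longrightarrow> s (\<alpha> \<bullet> \<beta>) = s \<beta>"
    and comp_assoc: "\<alpha> \<in> carrier C \<Longrightarrow> \<beta> \<in> carrier C \<Longrightarrow> \<gamma> \<in> carrier C \<Longrightarrow>
      s \<alpha> = r \<beta> \<Longrightarrow> s \<beta> = r \<gamma> \<Longrightarrow> (\<alpha> \<bullet> \<beta>) \<bullet> \<gamma> = \<alpha> \<bullet> (\<beta> \<bullet> \<gamma>)"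
    and rng_unit: "\<alpha> \<in> carrier C \<Longrightarrow> r \<alpha> \<bullet> \<alpha> = \<alpha>"
    and src_unit: "\<alpha> \<in> carrier C \<Longrightarrow> \<alpha> \<bullet> s \<alpha> = \<alpha>"

locale left_cancellative_small_category = small_category +
  assumes left_cancel: "\<alpha> \<in> carrier C \<Longrightarrow> \<beta> \<in> carrier C \<Longrightarrow> \<gamma> \<in> carrier C \<Longrightarrow>
      s \<alpha> = r \<beta> \<Longrightarrow> s \<alpha> = r \<gamma> \<Longrightarrow> \<alpha> \<bullet> \<beta> = \<alpha> \<bullet> \<gamma> \<Longrightarrow> \<beta> = \<gamma>"

section \<open>Partial bijections\<close>

text \<open>A partial map is an element of \<open>'a \<rightharpoonup> 'a\<close>; then \<open>(\<circ>\<^sub>m)\<close> is composition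
  (right factor first) on the largest possible domain.\<close>

definition partial_bijections :: "'a set \<Rightarrow> ('a \<rightharpoonup> 'a) semigroup_zero" where
  "partial_bijections A =
     \<lparr>carrier = {f. dom f \<subseteq> A \<and> ran f \<subseteq> A \<and> inj_on f (dom f)},
      mult = (\<circ>\<^sub>m), zero = Map.empty\<rparr>"

definition partial_inv :: "('a \<rightharpoonup> 'b) \<Rightarrow> ('b \<rightharpoonup> 'a)" where
  "partial_inv f y = (if y \<in> ran f then Some (SOME x. f x = Some y) else None)"

section \<open>Zigzags\<close>

definition tau :: "('a, 'b) category_data_scheme \<Rightarrow> 'a \<Rightarrow> ('a \<rightharpoonup> 'a)" where
  "tau C \<alpha> x = (if x \<in> carrier C \<and> s\<^bsub>C\<^esub> \<alpha> = r\<^bsub>C\<^esub> x then Some (\<alpha> \<bullet>\<^bsub>C\<^esub> x) else None)"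

text \<open>The tuple $(\alpha_1,\beta_1,\dots,\alpha_n,\beta_n)$ is the list of the pairs
  $(\alpha_i,\beta_i)$.\<close>

definition zigzag :: "('a, 'b) category_data_scheme \<Rightarrow> ('a \<times> 'a) list \<Rightarrow> bool" where
  "zigzag C \<zeta> \<longleftrightarrow> \<zeta> \<noteq> [] \<and> set \<zeta> \<subseteq> carrier C \<times> carrier C \<and>
     (\<forall>i < length \<zeta>. r\<^bsub>C\<^esub> (fst (\<zeta> ! i)) = r\<^bsub>C\<^esub> (snd (\<zeta> ! i))) \<and>
     (\<forall>i. Suc i < length \<zeta> \<longrightarrow> s\<^bsub>C\<^esub> (snd (\<zeta> ! i)) = s\<^bsub>C\<^esub> (fst (\<zeta> ! Suc i)))"

text \<open>\<open>Some\<close> is the identity map, neutral for \<open>(\<circ>\<^sub>m)\<close>.\<close>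

definition zigzag_map :: "('a, 'b) category_data_scheme \<Rightarrow> ('a \<times> 'a) list \<Rightarrow> ('a \<rightharpoonup> 'a)" where
  "zigzag_map C \<zeta> =
     foldr (\<lambda>(\<alpha>, \<beta>) f. (partial_inv (tau C \<alpha>) \<circ>\<^sub>m tau C \<beta>) \<circ>\<^sub>m f) \<zeta> Some"

definition ZM :: "('a, 'b) category_data_scheme \<Rightarrow> ('a \<rightharpoonup> 'a) semigroup_zero" where
  "ZM C = (partial_bijections (carrier C))
     \<lparr>carrier := {zigzag_map C \<zeta> |\<zeta>. zigzag C \<zeta>} \<union> {Map.empty}\<rparr>"


section \<open>The zigzag maps form an inverse semigroup with zero\<close>

lemma partial_inv_eq_Some_iff:
  assumes "inj_on f (dom f)"
  shows "partial_inv f y = Some x \<longleftrightarrow> f x = Some y"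
proof -
  have uniq: "x = x'" if "f x = Some y" "f x' = Some y" for x x'
    using assms that unfolding inj_on_def by (metis domI)
  show ?thesis
  proof
    assume *: "partial_inv f y = Some x"
    then have "y \<in> ran f" and x: "x = (SOME x. f x = Some y)"
      by (auto simp: partial_inv_def split: if_splits)
    then have "\<exists>x. f x = Some y" by (auto simp: ran_def)
    then show "f x = Some y" unfolding x by (rule someI_ex)
  next
    assume *: "f x = Some y"
    then have "f (SOME x. f x = Some y) = Some y" by (rule someI)
    then have "(SOME x. f x = Some y) = x" using * uniq by blast
    then show "partial_inv f y = Some x" using * by (auto simp: partial_inv_def ran_def)
  qed
qed

lemma map_eqI: "(\<And>x y. f x = Some y \<longleftrightarrow> g x = Some y) \<Longrightarrow> f = g"
  by (rule ext) (metis not_Some_eq)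

lemma map_comp_assoc: "(f \<circ>\<^sub>m g) \<circ>\<^sub>m h = f \<circ>\<^sub>m (g \<circ>\<^sub>m h)"
  by (rule map_eqI) (auto simp: map_comp_Some_iff)

lemma empty_map_comp: "Map.empty \<circ>\<^sub>m f = Map.empty"
  by (rule map_eqI) (simp add: map_comp_Some_iff)

lemma inj_partial_iff:
  "inj_on f (dom f) \<longleftrightarrow> (\<forall>x x' y. f x = Some y \<longrightarrow> f x' = Some y \<longrightarrow> x = x')"
  by (auto simp: inj_on_def dom_def)

lemma inj_map_comp:
  "inj_on f (dom f) \<Longrightarrow> inj_on g (dom g) \<Longrightarrow> inj_on (f \<circ>\<^sub>m g) (dom (f \<circ>\<^sub>m g))"
  unfolding inj_partial_iff map_comp_Some_iff by metis

lemma inj_partial_inv: "inj_on f (dom f) \<Longrightarrow> inj_on (partial_inv f) (dom (partial_inv f))"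
  by (subst inj_partial_iff) (auto simp: partial_inv_eq_Some_iff)

lemma partial_inv_comp:
  "inj_on f (dom f) \<Longrightarrow> inj_on g (dom g) \<Longrightarrow>
   partial_inv (f \<circ>\<^sub>m g) = partial_inv g \<circ>\<^sub>m partial_inv f"
  by (rule map_eqI)
    (auto simp: map_comp_Some_iff partial_inv_eq_Some_iff inj_map_comp)

lemma partial_inv_partial_inv: "inj_on f (dom f) \<Longrightarrow> partial_inv (partial_inv f) = f"
  by (rule map_eqI) (simp add: partial_inv_eq_Some_iff inj_partial_inv)

lemma inverse_of_partial_bijection_iff:
  assumes f: "inj_on f (dom f)" and g: "inj_on g (dom g)"
  shows "f \<circ>\<^sub>m g \<circ>\<^sub>m f = f \<and> g \<circ>\<^sub>m f \<circ>\<^sub>m g = g \<longleftrightarrow> g = partial_inv f"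
proof
  assume *: "f \<circ>\<^sub>m g \<circ>\<^sub>m f = f \<and> g \<circ>\<^sub>m f \<circ>\<^sub>m g = g"
  show "g = partial_inv f"
  proof (rule map_eqI)
    fix y x
    have "f x = Some y" if gy: "g y = Some x"
    proof -
      have "(g \<circ>\<^sub>m f \<circ>\<^sub>m g) y = Some x" using * that by simp
      then obtain z where "f x = Some z" "g z = Some x"
        using gy by (auto simp: map_comp_Some_iff)
      then show ?thesis using g that unfolding inj_partial_iff by blast
    qed
    moreover have "g y = Some x" if fx: "f x = Some y"
    proof -
      have "(f \<circ>\<^sub>m g \<circ>\<^sub>m f) x = Some y" using * that by simp
      then obtain z where "g y = Some z" "f z = Some y"
        using fx by (auto simp: map_comp_Some_iff)
      then show ?thesis using f that unfolding inj_partial_iff by blast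
    qed
    ultimately show "g y = Some x \<longleftrightarrow> partial_inv f y = Some x"
      using partial_inv_eq_Some_iff[OF f] by blast
  qed
next
  assume g: "g = partial_inv f"
  note iff = partial_inv_eq_Some_iff[OF f]
  have "f \<circ>\<^sub>m g \<circ>\<^sub>m f = f"
    unfolding g by (rule map_eqI) (auto simp: map_comp_Some_iff iff)
  moreover have "g \<circ>\<^sub>m f \<circ>\<^sub>m g = g"
    unfolding g by (rule map_eqI) (auto simp: map_comp_Some_iff iff)
  ultimately show "f \<circ>\<^sub>m g \<circ>\<^sub>m f = f \<and> g \<circ>\<^sub>m f \<circ>\<^sub>m g = g" ..
qed

lemma inverse_semigroup_zero_partial_bijectionsI:
  fixes T :: "('a \<rightharpoonup> 'a) set" and A :: "'a set"
  assumes S: "S = (partial_bijections A)\<lparr>carrier := T\<rparr>"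
    and sub: "T \<subseteq> carrier (partial_bijections A)" and "Map.empty \<in> T"
    and comp: "\<And>f g. f \<in> T \<Longrightarrow> g \<in> T \<Longrightarrow> f \<circ>\<^sub>m g \<in> T"
    and inv: "\<And>f. f \<in> T \<Longrightarrow> partial_inv f \<in> T"
  shows "inverse_semigroup_zero S"
    and "f \<in> T \<Longrightarrow> sg_inverse S f = partial_inv f"
proof -
  have inj: "inj_on f (dom f)" if "f \<in> T" for f
    using that sub by (auto simp: partial_bijections_def)
  have iff: "g \<in> T \<and> f \<circ>\<^sub>m g \<circ>\<^sub>m f = f \<and> g \<circ>\<^sub>m f \<circ>\<^sub>m g = g \<longleftrightarrow> g = partial_inv f"
    if "f \<in> T" for f g
    using that inv inj inverse_of_partial_bijection_iff by metis
  have [simp]: "carrier S = T" "mult S = (\<circ>\<^sub>m)" "zero S = Map.empty"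
    by (simp_all add: S partial_bijections_def)
  show "inverse_semigroup_zero S"
  proof
    fix f assume "f \<in> carrier S"
    then show "\<exists>!g. g \<in> carrier S \<and> f \<odot>\<^bsub>S\<^esub> g \<odot>\<^bsub>S\<^esub> f = f \<and> g \<odot>\<^bsub>S\<^esub> f \<odot>\<^bsub>S\<^esub> g = g"
      using iff[of f] by simp
  qed (use assms(2-) in \<open>auto simp: map_comp_assoc comp empty_map_comp\<close>)
  show "sg_inverse S f = partial_inv f" if "f \<in> T"
    using iff[OF that] by (simp add: sg_inverse_def)
qed

lemma zigzag_map_Cons:
  "zigzag_map C ((\<alpha>, \<beta>) # \<zeta>) = (partial_inv (tau C \<alpha>) \<circ>\<^sub>m tau C \<beta>) \<circ>\<^sub>m zigzag_map C \<zeta>"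
  by (simp add: zigzag_map_def)

lemma zigzag_map_Nil: "zigzag_map C [] = Some"
  by (simp add: zigzag_map_def)

lemma Some_map_comp: "Some \<circ>\<^sub>m f = f" 
  by (rule map_eqI) (auto simp: map_comp_Some_iff)

lemma map_comp_Some: "f \<circ>\<^sub>m Some = f" 
  by (rule map_eqI) (auto simp: map_comp_Some_iff)

lemma zigzag_map_append: "zigzag_map C (\<zeta> @ \<xi>) = zigzag_map C \<zeta> \<circ>\<^sub>m zigzag_map C \<xi>"
  by (induction \<zeta>) (auto simp: zigzag_map_Nil zigzag_map_Cons Some_map_comp map_comp_assoc)

definition zigzag_rev :: "('a \<times> 'a) list \<Rightarrow> ('a \<times> 'a) list" where
  "zigzag_rev \<zeta> = rev (map prod.swap \<zeta>)"

context left_cancellative_small_category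
begin

lemma inj_tau: "\<alpha> \<in> carrier C \<Longrightarrow> inj_on (tau C \<alpha>) (dom (tau C \<alpha>))"
  unfolding inj_partial_iff by (auto simp: tau_def left_cancel split: if_splits)

lemma inj_zigzag_map:
  "set \<zeta> \<subseteq> carrier C \<times> carrier C \<Longrightarrow> inj_on (zigzag_map C \<zeta>) (dom (zigzag_map C \<zeta>))"
proof (induction \<zeta>)
  case Nil
  then show ?case by (simp add: zigzag_map_Nil)
next
  case (Cons p \<zeta>)
  then show ?case
    by (cases p) (simp add: zigzag_map_Cons inj_map_comp inj_partial_inv inj_tau)
qed

lemma partial_inv_zigzag_map:
  "set \<zeta> \<subseteq> carrier C \<times> carrier C \<Longrightarrow>
   partial_inv (zigzag_map C \<zeta>) = zigzag_map C (zigzag_rev \<zeta>)"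
proof (induction \<zeta>)
  case Nil
  have "partial_inv Some = (Some :: 'a \<rightharpoonup> 'a)"
    by (rule map_eqI) (auto simp: partial_inv_eq_Some_iff)
  then show ?case by (simp add: zigzag_map_Nil zigzag_rev_def)
next
  case (Cons p \<zeta>)
  then show ?case
    by (cases p) (simp add: zigzag_map_Cons inj_map_comp inj_partial_inv inj_tau inj_zigzag_map
      partial_inv_comp partial_inv_partial_inv zigzag_rev_def zigzag_map_append zigzag_map_Nil
      map_comp_Some)
qed

lemma zigzag_map_SomeD:
  assumes "zigzag C \<zeta>" and "zigzag_map C \<zeta> x = Some y"
  shows "x \<in> carrier C" "y \<in> carrier C" "r x = s (snd (last \<zeta>))" "r y = s (fst (hd \<zeta>))"
proof -
  have "x \<in> carrier C \<and> r x = s (snd (last \<zeta>))"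
  proof -
    obtain \<alpha> \<beta> \<xi> where "\<zeta> = \<xi> @ [(\<alpha>, \<beta>)]" 
      using assms by (cases \<zeta> rule: rev_cases) (auto simp: zigzag_def)
    then show ?thesis using assms
      by (auto simp: zigzag_map_append zigzag_map_Cons zigzag_map_Nil map_comp_Some
        map_comp_Some_iff tau_def split: if_splits)
  qed
  then show "x \<in> carrier C" "r x = s (snd (last \<zeta>))" by auto
  have "y \<in> carrier C \<and> r y = s (fst (hd \<zeta>))"
  proof -
    obtain \<alpha> \<beta> \<xi> where \<zeta>: "\<zeta> = (\<alpha>, \<beta>) # \<xi>"
      using assms by (cases \<zeta>) (auto simp: zigzag_def)
    then have "\<alpha> \<in> carrier C" using assms by (auto simp: zigzag_def)
    then show ?thesis using assms \<zeta>
      by (auto simp: zigzag_map_Cons map_comp_Some_iff partial_inv_eq_Some_iff inj_tau tau_def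
        split: if_splits)
  qed
  then show "y \<in> carrier C" "r y = s (fst (hd \<zeta>))" by auto
qed

lemma zigzag_append:
  assumes "zigzag C \<zeta>" "zigzag C \<xi>" "s (snd (last \<zeta>)) = s (fst (hd \<xi>))"
  shows "zigzag C (\<zeta> @ \<xi>)"
proof -
  have "s (snd ((\<zeta> @ \<xi>) ! i)) = s (fst ((\<zeta> @ \<xi>) ! Suc i))" if "Suc i < length (\<zeta> @ \<xi>)" for i
  proof -
    consider "Suc i < length \<zeta>" | "Suc i = length \<zeta>" | "length \<zeta> \<le> i" by linarith
    then show ?thesis
    proof cases
      case 2
      then have "last \<zeta> = \<zeta> ! i" "hd \<xi> = \<xi> ! 0"
        using assms by (auto simp: zigzag_def last_conv_nth hd_conv_nth simp flip: 2)
      then show ?thesis using 2 assms by (simp add: nth_append)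
    qed (use assms that in \<open>auto simp: zigzag_def nth_append Suc_diff_le\<close>)
  qed
  then show ?thesis using assms by (auto simp: zigzag_def nth_append)
qed

lemma zigzag_zigzag_rev: 
  assumes "zigzag C \<zeta>"
  shows "zigzag C (zigzag_rev \<zeta>)"
proof -
  have "s (snd (zigzag_rev \<zeta> ! i)) = s (fst (zigzag_rev \<zeta> ! Suc i))" if "Suc i < length \<zeta>" for i
  proof -
    have "length \<zeta> - Suc i = Suc (length \<zeta> - Suc (Suc i))" using that by simp
    then show ?thesis using assms that by (simp add: zigzag_def zigzag_rev_def rev_nth)
  qed
  then show ?thesis using assms by (auto simp: zigzag_def zigzag_rev_def rev_nth)
qed

lemma shows ZM_inverse_semigroup: "inverse_semigroup_zero (ZM C)"
  and ZM_inverse: "f \<in> carrier (ZM C) \<Longrightarrow> sg_inverse (ZM C) f = partial_inv f"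
proof -
  let ?T = "{zigzag_map C \<zeta> |\<zeta>. zigzag C \<zeta>} \<union> {Map.empty}"
  have 1: "?T \<subseteq> carrier (partial_bijections (carrier C))"
  proof
    fix f assume "f \<in> ?T"
    then consider "f = Map.empty" | \<zeta> where "zigzag C \<zeta>" "f = zigzag_map C \<zeta>" by blast
    then show "f \<in> carrier (partial_bijections (carrier C))"
    proof cases
      case 2
      then have "inj_on f (dom f)" by (simp add: zigzag_def inj_zigzag_map)
      moreover have "dom f \<subseteq> carrier C" "ran f \<subseteq> carrier C"
        using 2 zigzag_map_SomeD by (auto simp: ran_def)
      ultimately show ?thesis by (simp add: partial_bijections_def)
    qed (simp add: partial_bijections_def)
  qed
  have 2: "f \<circ>\<^sub>m g \<in> ?T" if fg: "f \<in> ?T" "g \<in> ?T" for f g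
  proof (cases "f = Map.empty \<or> g = Map.empty \<or> f \<circ>\<^sub>m g = Map.empty")
    case True
    then show ?thesis by auto
  next
    case False
    with fg obtain \<zeta> \<xi> where z: "zigzag C \<zeta>" "f = zigzag_map C \<zeta>" "zigzag C \<xi>" "g = zigzag_map C \<xi>"
      by auto
    from False obtain x z where "(f \<circ>\<^sub>m g) x = Some z" by (metis map_eqI option.distinct(1))
    then obtain y where "g x = Some y" "f y = Some z" by (auto simp: map_comp_Some_iff)
    then have "s (snd (last \<zeta>)) = s (fst (hd \<xi>))" using z zigzag_map_SomeD by metis
    then have "zigzag C (\<zeta> @ \<xi>)" using z by (intro zigzag_append)
    moreover have "f \<circ>\<^sub>m g = zigzag_map C (\<zeta> @ \<xi>)" using z by (simp add: zigzag_map_append)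
    ultimately show ?thesis by blast
  qed
  have 3: "partial_inv f \<in> ?T" if f: "f \<in> ?T" for f
  proof (cases "f = Map.empty")
    case True
    then have "partial_inv f = Map.empty" by (auto simp: partial_inv_def)
    then show ?thesis by simp
  next
    case False
    then obtain \<zeta> where "zigzag C \<zeta>" "f = zigzag_map C \<zeta>" using f by auto
    then have "zigzag C (zigzag_rev \<zeta>)" "partial_inv f = zigzag_map C (zigzag_rev \<zeta>)"
      by (simp_all add: zigzag_zigzag_rev partial_inv_zigzag_map zigzag_def[of C \<zeta>])
    then show ?thesis by blast
  qed
  have 0: "Map.empty \<in> ?T" by simp
  show "inverse_semigroup_zero (ZM C)"
    using inverse_semigroup_zero_partial_bijectionsI(1)[OF ZM_def 1 0 2 3] .
  show "sg_inverse (ZM C) f = partial_inv f" if "f \<in> carrier (ZM C)"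
  proof -
    have "f \<in> ?T" using that by (simp add: ZM_def)
    then show ?thesis
      using inverse_semigroup_zero_partial_bijectionsI(2)[OF ZM_def 1 0 2 3] by blast
  qed
qed

end

end

theory Submission
  imports Defs
begin

text \<open>An idempotent of \<open>ZM C\<close> is the identity map of its domain, and the order of idempotents is
  inclusion of domains. The elements of a zigzag map's domain all have the same range (the source of
  the last entry of the zigzag), so a nonzero idempotent lies below the identity map of \<open>v C\<close> for
  exactly one object \<open>v\<close>. That map is \<open>\<tau>\<^sub>v\<close>, itself a zigzag map. Hence the maximal idempotents
  are the maps \<open>\<tau>\<^sub>v\<close> of objects \<open>v\<close>, and each nonzero idempotent is below exactly one of
  them.

  The other two claims rest on the fact that a zigzag map \<open>f\<close> commutes with the right action
  of the category: if \<open>f x = y\<close>, then \<open>f (x z) = y z\<close> for every \<open>z\<close> composable with \<open>x\<close>, and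
  \<open>x\<close> and \<open>y\<close> have the same source. It holds for each \<open>\<tau>\<^sub>\<alpha>\<close> and passes to partial inverses and
  composites. Consequently a path, whose domain has the form \<open>v C\<close>, is determined by its value \<open>\<alpha>\<close>
  at \<open>v\<close>: it sends \<open>z = v z\<close> to \<open>\<alpha> z\<close>, so it is \<open>\<tau>\<^sub>\<alpha>\<close>. Moreover the domain of \<open>f\<close> is a right ideal,
  so it contains \<open>\<alpha> C\<close>, the image of \<open>\<tau>\<^sub>\<alpha>\<close>, as soon as it contains \<open>\<alpha>\<close>; this
  describes the domain paths.\<close>

section \<open>Partial identities\<close>

lemma dom_partial_identity: "dom (Some |` A) = A"
  by (auto simp: dom_def restrict_map_def)

lemma partial_inv_map_comp_self:
  "inj_on f (dom f) \<Longrightarrow> partial_inv f \<circ>\<^sub>m f = Some |` dom f"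
  by (rule map_eqI)
    (auto simp: map_comp_Some_iff partial_inv_eq_Some_iff restrict_map_def inj_partial_iff)

lemma map_comp_partial_inv_self:
  "inj_on f (dom f) \<Longrightarrow> f \<circ>\<^sub>m partial_inv f = Some |` ran f"
  by (rule map_eqI)
    (auto simp: map_comp_Some_iff partial_inv_eq_Some_iff restrict_map_def ran_def)

lemma idempotent_partial_bijection:
  assumes inj: "inj_on f (dom f)" and idem: "f \<circ>\<^sub>m f = f"
  shows "f = Some |` dom f"
proof -
  have fixed: "x = y" if xy: "f x = Some y" for x y
  proof -
    have "f y = Some y" using idem xy by (metis map_comp_simps(2))
    with inj xy show ?thesis unfolding inj_partial_iff by blast
  qed
  show ?thesis
    by (rule map_eqI) (auto simp: restrict_map_def dest: fixed)
qed

lemma idem_le_partial_identity_iff: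
  assumes "mult S = (\<circ>\<^sub>m)"
  shows "idem_le S (Some |` A) (Some |` B) \<longleftrightarrow> A \<subseteq> B"
proof -
  have "Some |` A \<circ>\<^sub>m Some |` B = Some |` (A \<inter> B)"
    by (rule map_eqI) (auto simp: map_comp_Some_iff restrict_map_def)
  moreover have "Some |` A = Some |` (A \<inter> B) \<longleftrightarrow> A = A \<inter> B"
    by (metis dom_partial_identity)
  ultimately show ?thesis using assms by (auto simp: idem_le_def)
qed

lemma ZM_simps [simp]: "mult (ZM C) = (\<circ>\<^sub>m)" "zero (ZM C) = Map.empty"
  by (simp_all add: ZM_def partial_bijections_def)

lemma zigzag_map_in_ZM: "zigzag C \<zeta> \<Longrightarrow> zigzag_map C \<zeta> \<in> carrier (ZM C)"
  unfolding ZM_def by simp blast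

context left_cancellative_small_category
begin

section \<open>Equivariance of zigzag maps\<close>

text \<open>\<open>x\<close> and \<open>y\<close> are not confined to the carrier because the empty list of pairs has
  the total map \<open>Some\<close> as its zigzag map, and inductions over zigzags start there.\<close>

definition right_equivariant :: "('a \<rightharpoonup> 'a) \<Rightarrow> bool" where
  "right_equivariant f \<longleftrightarrow>
     (\<forall>x y. f x = Some y \<longrightarrow> s y = s x \<and> (\<forall>z \<in> carrier C. s x = r z \<longrightarrow> f (x \<bullet> z) = Some (y \<bullet> z)))"

lemma right_equivariant_tau: "\<alpha> \<in> carrier C \<Longrightarrow> right_equivariant (tau C \<alpha>)"
  by (auto simp: right_equivariant_def tau_def src_comp rng_comp comp_closed comp_assoc
    split: if_splits)

lemma right_equivariant_partial_inv:
  "inj_on f (dom f) \<Longrightarrow> right_equivariant f \<Longrightarrow> right_equivariant (partial_inv f)"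
  by (simp add: right_equivariant_def partial_inv_eq_Some_iff)

lemma right_equivariant_comp:
  "right_equivariant f \<Longrightarrow> right_equivariant g \<Longrightarrow> right_equivariant (f \<circ>\<^sub>m g)"
  by (fastforce simp: right_equivariant_def map_comp_Some_iff)

lemma right_equivariant_zigzag_map:
  "set \<zeta> \<subseteq> carrier C \<times> carrier C \<Longrightarrow> right_equivariant (zigzag_map C \<zeta>)"
proof (induction \<zeta>)
  case Nil
  then show ?case by (simp add: zigzag_map_Nil right_equivariant_def)
next
  case (Cons p \<zeta>)
  then show ?case
    by (cases p) (simp add: zigzag_map_Cons right_equivariant_comp right_equivariant_partial_inv
      right_equivariant_tau inj_tau)
qed

lemma ZM_inj: "f \<in> carrier (ZM C) \<Longrightarrow> inj_on f (dom f)"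
  by (auto simp: ZM_def zigzag_def inj_zigzag_map)

lemma ZM_right_equivariant: "f \<in> carrier (ZM C) \<Longrightarrow> right_equivariant f"
  by (auto simp: ZM_def zigzag_def right_equivariant_zigzag_map)
    (simp add: right_equivariant_def)

lemma ZM_dom_carrier: "f \<in> carrier (ZM C) \<Longrightarrow> dom f \<subseteq> carrier C"
  by (auto simp: ZM_def dest: zigzag_map_SomeD(1))

lemma ZM_ran_carrier: "f \<in> carrier (ZM C) \<Longrightarrow> ran f \<subseteq> carrier C"
  by (auto simp: ZM_def ran_def dest: zigzag_map_SomeD(2))

lemma ZM_dom_same_rng:
  "f \<in> carrier (ZM C) \<Longrightarrow> x \<in> dom f \<Longrightarrow> y \<in> dom f \<Longrightarrow> r x = r y"
  by (auto simp: ZM_def) (metis zigzag_map_SomeD(3))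

lemma ZM_dom_right_ideal:
  assumes "f \<in> carrier (ZM C)" "x \<in> dom f" "z \<in> carrier C" "s x = r z"
  shows "x \<bullet> z \<in> dom f"
  using ZM_right_equivariant[OF assms(1)] assms(2-) by (auto simp: right_equivariant_def)

lemma ZM_source_projection:
  "f \<in> carrier (ZM C) \<Longrightarrow> sg_inverse (ZM C) f \<odot>\<^bsub>ZM C\<^esub> f = Some |` dom f"
  by (simp add: ZM_inverse partial_inv_map_comp_self ZM_inj)

lemma ZM_range_projection:
  "f \<in> carrier (ZM C) \<Longrightarrow> f \<odot>\<^bsub>ZM C\<^esub> sg_inverse (ZM C) f = Some |` ran f"
  by (simp add: ZM_inverse map_comp_partial_inv_self ZM_inj)

section \<open>The maps \<open>\<tau>\<^sub>\<alpha>\<close> in the zigzag semigroup\<close>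

lemma dom_tau: "dom (tau C \<alpha>) = {x \<in> carrier C. r x = s \<alpha>}"
  by (auto simp: tau_def split: if_splits)

lemma ran_tau: "ran (tau C \<alpha>) = {\<alpha> \<bullet> x |x. x \<in> carrier C \<and> s \<alpha> = r x}"
  by (auto simp: tau_def ran_def split: if_splits)

lemma tau_object: "v \<in> objects C \<Longrightarrow> tau C v = Some |` {x \<in> carrier C. r x = v}"
  by (rule map_eqI) (auto simp: tau_def restrict_map_def src_of_object rng_unit split: if_splits)

lemma tau_object_self: "v \<in> objects C \<Longrightarrow> tau C v v = Some v"
  using objects_subset by (auto simp: tau_object rng_of_object)

text \<open>\<open>\<tau>\<^sub>\<alpha>\<close> is the map of the zigzag \<open>(r \<alpha>, \<alpha>)\<close>, since \<open>\<tau>\<close> of an object is a partial identity.\<close>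

lemma tau_in_ZM:
  assumes \<alpha>: "\<alpha> \<in> carrier C"
  shows "tau C \<alpha> \<in> carrier (ZM C)"
proof -
  have obj: "r \<alpha> \<in> objects C" and rC: "r \<alpha> \<in> carrier C"
    using \<alpha> rng_object objects_subset by auto
  have "partial_inv (tau C (r \<alpha>)) \<circ>\<^sub>m tau C \<alpha> = tau C \<alpha>"
    by (rule map_eqI) (auto simp: map_comp_Some_iff partial_inv_eq_Some_iff inj_tau rC,
      auto simp: tau_def src_of_object[OF obj] rng_comp comp_closed rng_unit \<alpha> split: if_splits)
  then have "zigzag_map C [(r \<alpha>, \<alpha>)] = tau C \<alpha>"
    by (simp add: zigzag_map_Cons zigzag_map_Nil map_comp_Some)
  moreover have "zigzag C [(r \<alpha>, \<alpha>)]"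
    using \<alpha> rC obj by (simp add: zigzag_def rng_of_object)
  ultimately show ?thesis unfolding ZM_def by force
qed

section \<open>Maximal idempotents\<close>

lemma ZM_idempotentD:
  "e \<in> idempotents (ZM C) \<Longrightarrow> e \<in> carrier (ZM C) \<and> e = Some |` dom e"
  by (simp add: idempotents_def idempotent_partial_bijection ZM_inj)

lemma idem_le_tau_object_iff:
  assumes e: "e \<in> idempotents (ZM C)" and v: "v \<in> objects C"
  shows "idem_le (ZM C) e (tau C v) \<longleftrightarrow> (\<forall>x \<in> dom e. r x = v)"
proof -
  have "idem_le (ZM C) e (tau C v) \<longleftrightarrow> dom e \<subseteq> {x \<in> carrier C. r x = v}"
    unfolding tau_object[OF v]
    by (subst conjunct2[OF ZM_idempotentD[OF e]])
      (rule idem_le_partial_identity_iff[OF ZM_simps(1)])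
  moreover have "dom e \<subseteq> carrier C" using ZM_dom_carrier ZM_idempotentD[OF e] by blast
  ultimately show ?thesis by blast
qed

lemma ex1_object_above_idempotent:
  assumes e: "e \<in> idempotents (ZM C)" and nz: "e \<noteq> Map.empty"
  shows "\<exists>!v. v \<in> objects C \<and> idem_le (ZM C) e (tau C v)"
proof -
  have eZ: "e \<in> carrier (ZM C)" using ZM_idempotentD[OF e] by blast
  obtain x where x: "x \<in> dom e" using nz by auto
  then have obj: "r x \<in> objects C" using ZM_dom_carrier[OF eZ] rng_object by blast
  show ?thesis
  proof (rule ex1I[of _ "r x"])
    show "r x \<in> objects C \<and> idem_le (ZM C) e (tau C (r x))"
      using obj idem_le_tau_object_iff[OF e obj] ZM_dom_same_rng[OF eZ _ x] by blast
  next
    fix v assume "v \<in> objects C \<and> idem_le (ZM C) e (tau C v)"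
    then show "v = r x" using idem_le_tau_object_iff[OF e, of v] x by auto
  qed
qed

lemma tau_object_idempotent:
  assumes "v \<in> objects C"
  shows "tau C v \<in> idempotents (ZM C)" and "tau C v \<noteq> Map.empty"
proof -
  have "tau C v \<circ>\<^sub>m tau C v = tau C v"
    using assms by (intro map_eqI) (auto simp: tau_object map_comp_Some_iff restrict_map_def)
  moreover have "tau C v \<in> carrier (ZM C)" using assms objects_subset tau_in_ZM by blast
  ultimately show "tau C v \<in> idempotents (ZM C)" by (simp add: idempotents_def)
  show "tau C v \<noteq> Map.empty" using tau_object_self[OF assms] by auto
qed

text \<open>An idempotent above \<open>\<tau>\<^sub>v\<close> is in turn below some \<open>\<tau>\<^sub>w\<close>; its domain contains \<open>v\<close>, whose range is
  \<open>v\<close>, so \<open>w = v\<close>. Conversely every nonzero idempotent is below some \<open>\<tau>\<^sub>v\<close>, so no other one can be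
  maximal.\<close>

lemma maximal_idempotent_ZM_iff:
  "maximal_idempotent (ZM C) e \<longleftrightarrow> (\<exists>v \<in> objects C. e = tau C v)"
proof
  assume max: "maximal_idempotent (ZM C) e"
  then have "e \<in> idempotents (ZM C)" "e \<noteq> Map.empty" by (auto simp: maximal_idempotent_def)
  then obtain v where "v \<in> objects C" "idem_le (ZM C) e (tau C v)"
    using ex1_object_above_idempotent by blast
  then show "\<exists>v \<in> objects C. e = tau C v"
    using max tau_object_idempotent by (auto simp: maximal_idempotent_def)
next
  assume "\<exists>v \<in> objects C. e = tau C v"
  then obtain v where v: "v \<in> objects C" and e: "e = tau C v" by blast
  have "f = e" if f: "f \<in> idempotents (ZM C)" "f \<noteq> Map.empty" and le: "idem_le (ZM C) e f" for f
  proof -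
    let ?V = "{x \<in> carrier C. r x = v}"
    obtain A where fid: "f = Some |` A" and fZ: "f \<in> carrier (ZM C)"
      using ZM_idempotentD[OF f(1)] by blast
    have "?V \<subseteq> dom f"
      using le unfolding e tau_object[OF v] fid dom_partial_identity
        idem_le_partial_identity_iff[OF ZM_simps(1)] .
    moreover from this have "v \<in> dom f" using v objects_subset rng_of_object by blast
    then have "dom f \<subseteq> ?V"
      using ZM_dom_same_rng[OF fZ, of _ v] ZM_dom_carrier[OF fZ] by (auto simp: rng_of_object[OF v])
    ultimately have "dom f = ?V" by blast
    then show "f = e" unfolding fid e tau_object[OF v] dom_partial_identity by simp
  qed
  then show "maximal_idempotent (ZM C) e"
    using tau_object_idempotent[OF v] by (simp add: maximal_idempotent_def e)
qed

lemma ZM_admits_unique_maximal_idempotents: "admits_unique_maximal_idempotents (ZM C)"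
  unfolding admits_unique_maximal_idempotents_def
proof (intro ballI impI)
  fix e assume "e \<in> idempotents (ZM C)" "e \<noteq> \<zero>\<^bsub>ZM C\<^esub>"
  then have "\<exists>!v. v \<in> objects C \<and> idem_le (ZM C) e (tau C v)"
    by (simp add: ex1_object_above_idempotent)
  then show "\<exists>!f. maximal_idempotent (ZM C) f \<and> idem_le (ZM C) e f"
    unfolding maximal_idempotent_ZM_iff by metis
qed

section \<open>Paths\<close>

text \<open>If the domain of a zigzag map is \<open>v C\<close>, the value at the identity \<open>v\<close> determines it by
  equivariance.\<close>

lemma ZM_eq_tauI:
  assumes f: "f \<in> carrier (ZM C)" and v: "v \<in> objects C"
    and dom: "dom f = {x \<in> carrier C. r x = v}" and fv: "f v = Some \<alpha>"
  shows "f = tau C \<alpha>"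
proof (rule ext)
  fix x
  have eqv: "s \<alpha> = s v" "\<And>z. z \<in> carrier C \<Longrightarrow> s v = r z \<Longrightarrow> f (v \<bullet> z) = Some (\<alpha> \<bullet> z)"
    using ZM_right_equivariant[OF f] fv by (auto simp: right_equivariant_def)
  show "f x = tau C \<alpha> x"
  proof (cases "x \<in> dom f")
    case True
    then have x: "x \<in> carrier C" "r x = v" using dom by auto
    then have "f x = Some (\<alpha> \<bullet> x)"
      using eqv(2)[OF x(1)] rng_unit[OF x(1)] v by (simp add: src_of_object)
    with x show ?thesis using eqv(1) v by (simp add: tau_def src_of_object)
  next
    case False
    then have "tau C \<alpha> x = None" using dom eqv(1) v by (auto simp: tau_def src_of_object)
    with False show ?thesis by auto
  qed
qed

lemma tau_in_paths:
  assumes \<alpha>: "\<alpha> \<in> carrier C"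
  shows "tau C \<alpha> \<in> sg_paths (ZM C)"
proof -
  have "sg_inverse (ZM C) (tau C \<alpha>) \<odot>\<^bsub>ZM C\<^esub> tau C \<alpha> = tau C (s \<alpha>)"
    unfolding ZM_source_projection[OF tau_in_ZM[OF \<alpha>]] tau_object[OF src_object[OF \<alpha>]] dom_tau ..
  then show ?thesis
    using src_object[OF \<alpha>] tau_in_ZM[OF \<alpha>] maximal_idempotent_ZM_iff by (auto simp: sg_paths_def)
qed

lemma sg_paths_ZM: "sg_paths (ZM C) = {tau C \<alpha> |\<alpha>. \<alpha> \<in> carrier C}"
proof
  show "{tau C \<alpha> |\<alpha>. \<alpha> \<in> carrier C} \<subseteq> sg_paths (ZM C)" using tau_in_paths by blast
  show "sg_paths (ZM C) \<subseteq> {tau C \<alpha> |\<alpha>. \<alpha> \<in> carrier C}"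
  proof
    fix f assume "f \<in> sg_paths (ZM C)"
    then have f: "f \<in> carrier (ZM C)" and "maximal_idempotent (ZM C) (Some |` dom f)"
      using ZM_source_projection by (auto simp: sg_paths_def)
    then obtain v where v: "v \<in> objects C" and eq: "Some |` dom f = tau C v"
      unfolding maximal_idempotent_ZM_iff by blast
    have "dom f = dom (Some |` dom f)" by (rule dom_partial_identity[symmetric])
    also have "\<dots> = {x \<in> carrier C. r x = v}" unfolding eq dom_tau src_of_object[OF v] ..
    finally have dom: "dom f = {x \<in> carrier C. r x = v}" .
    then have "v \<in> dom f" using v objects_subset rng_of_object by auto
    then obtain \<alpha> where fv: "f v = Some \<alpha>" by blast
    then have "\<alpha> \<in> carrier C" using ZM_ran_carrier[OF f] by (auto simp: ran_def)
    with ZM_eq_tauI[OF f v dom fv] show "f \<in> {tau C \<alpha> |\<alpha>. \<alpha> \<in> carrier C}" by blast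
  qed
qed

lemma ran_tau_subset_dom_iff:
  assumes f: "f \<in> carrier (ZM C)" and \<alpha>: "\<alpha> \<in> carrier C"
  shows "ran (tau C \<alpha>) \<subseteq> dom f \<longleftrightarrow> \<alpha> \<in> dom f"
proof
  have "s \<alpha> \<in> carrier C" using src_object[OF \<alpha>] objects_subset by blast
  then have "\<alpha> \<in> ran (tau C \<alpha>)"
    unfolding ran_tau using src_unit[OF \<alpha>] rng_of_object[OF src_object[OF \<alpha>]] by force
  then show "ran (tau C \<alpha>) \<subseteq> dom f \<Longrightarrow> \<alpha> \<in> dom f" by blast
  show "\<alpha> \<in> dom f \<Longrightarrow> ran (tau C \<alpha>) \<subseteq> dom f"
    unfolding ran_tau using ZM_dom_right_ideal[OF f] by blast
qed

lemma tau_in_domain_paths_iff: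
  assumes f: "f \<in> carrier (ZM C)" and \<alpha>: "\<alpha> \<in> carrier C"
  shows "tau C \<alpha> \<in> domain_paths (ZM C) f \<longleftrightarrow> \<alpha> \<in> dom f"
  unfolding domain_paths_def ZM_source_projection[OF f]
  by (simp del: ZM_simps add: tau_in_paths[OF \<alpha>] ZM_range_projection[OF tau_in_ZM[OF \<alpha>]]
    idem_le_partial_identity_iff[OF ZM_simps(1)] ran_tau_subset_dom_iff[OF f \<alpha>])

lemma domain_paths_ZM:
  assumes f: "f \<in> carrier (ZM C)"
  shows "domain_paths (ZM C) f = {tau C \<alpha> |\<alpha>. \<alpha> \<in> dom f}"
proof -
  have "domain_paths (ZM C) f \<subseteq> {tau C \<alpha> |\<alpha>. \<alpha> \<in> carrier C}"
    unfolding sg_paths_ZM[symmetric] by (auto simp: domain_paths_def)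
  then show ?thesis
    using tau_in_domain_paths_iff[OF f] ZM_dom_carrier[OF f] by blast
qed

end

theorem lemma5p4:
  fixes C :: "('a, 'b) category_data_scheme"
  assumes "left_cancellative_small_category C"
  shows "admits_unique_maximal_idempotents (ZM C) \<and>
    sg_paths (ZM C) = {tau C \<alpha> |\<alpha>. \<alpha> \<in> carrier C} \<and>
    (\<forall>\<zeta>. zigzag C \<zeta> \<longrightarrow>
      domain_paths (ZM C) (zigzag_map C \<zeta>) = {tau C \<alpha> |\<alpha>. \<alpha> \<in> dom (zigzag_map C \<zeta>)})"
  using left_cancellative_small_category.ZM_admits_unique_maximal_idempotents[OF assms]
    left_cancellative_small_category.sg_paths_ZM[OF assms]
    left_cancellative_small_category.domain_paths_ZM[OF assms zigzag_map_in_ZM]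
  by (intro conjI allI impI)

end
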